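(* Consider a horn angle formed by two circles in the Euclidean plane that are tangent to each other at the vertex of the angle. (i) If the two circles lie on the same side of their common tangent, then the metric bisector of the horn angle is the ellipse passing through the angle vertex, with foci at the centers of the circles, and the major axis equal to the sum of their radii. (ii) If the two circles lie on opposite sides of their common tangent, then the metric bisector of the horn angle is the branch of the hyperbola passing through the angle vertex, with foci at the centers of the circles, and the major axis equal to the difference of their radii.
   Context: A horn angle formed by two circles is the curvilinear angle whose sides are two circles tangent to each other, with vertex at the point of tangency; the common tangent is the tangent line to both circles at that point. A curve is called the metric bisector of a curvilinear angle if each point on it is equidistant from both sides of the angle. An ellipse is the locus of points the sum of whose distances to two fixed points, called foci, is constant, and this sum is equal to its major axis. A hyperbola is described similarly, with the difference of the distances to the two foci in place of the sum. *)

theory Defs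
  imports "HOL-Analysis.Analysis"
begin

text \<open>The Euclidean plane is \<^typ>\<open>real^2\<close>; the circle with centre \<open>c\<close> and radius \<open>r\<close> is
  \<^term>\<open>sphere c r\<close>.\<close>

definition tangent_line :: "(real^2) set \<Rightarrow> real^2 \<Rightarrow> real \<Rightarrow> real^2 \<Rightarrow> bool" where
  "tangent_line L c r V \<longleftrightarrow> affine L \<and> aff_dim L = 1 \<and> L \<inter> sphere c r = {V}"

text \<open>The common tangent \<open>L\<close> is determined by the remaining arguments; it is an argument only so that
  one can speak about its sides.\<close>

definition horn_angle ::
    "real^2 \<Rightarrow> real \<Rightarrow> real^2 \<Rightarrow> real \<Rightarrow> real^2 \<Rightarrow> (real^2) set \<Rightarrow> bool" where
  "horn_angle c1 r1 c2 r2 V L \<longleftrightarrow>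
     0 < r1 \<and> 0 < r2 \<and> sphere c1 r1 \<noteq> sphere c2 r2 \<and>
     tangent_line L c1 r1 V \<and> tangent_line L c2 r2 V"

text \<open>The sides of a line are the two closed half-planes it bounds: a circle touches its tangent.\<close>

definition same_side :: "(real^2) set \<Rightarrow> (real^2) set \<Rightarrow> (real^2) set \<Rightarrow> bool" where
  "same_side L S T \<longleftrightarrow>
     (\<exists>a b. a \<noteq> 0 \<and> L = {x. a \<bullet> x = b} \<and> S \<subseteq> {x. a \<bullet> x \<le> b} \<and> T \<subseteq> {x. a \<bullet> x \<le> b})"

definition opposite_sides :: "(real^2) set \<Rightarrow> (real^2) set \<Rightarrow> (real^2) set \<Rightarrow> bool" where
  "opposite_sides L S T \<longleftrightarrow>
     (\<exists>a b. a \<noteq> 0 \<and> L = {x. a \<bullet> x = b} \<and> S \<subseteq> {x. a \<bullet> x \<le> b} \<and> T \<subseteq> {x. a \<bullet> x \<ge> b})"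

text \<open>Injectivity is required only in the interior of the parameter interval, so that closed curves
  are included; the interval may be unbounded.\<close>

definition curve :: "(real^2) set \<Rightarrow> bool" where
  "curve C \<longleftrightarrow>
     (\<exists>(I :: real set) \<gamma>. is_interval I \<and> interior I \<noteq> {} \<and> continuous_on I \<gamma> \<and>
        inj_on \<gamma> (interior I) \<and> \<gamma> ` I = C)"

definition metric_bisector :: "(real^2) set \<Rightarrow> (real^2) set \<Rightarrow> (real^2) set \<Rightarrow> bool" where
  "metric_bisector S T C \<longleftrightarrow> curve C \<and> (\<forall>P\<in>C. infdist P S = infdist P T)"

text \<open>In both cases \<open>m\<close> is the (full) major axis. For \<open>m = 0\<close> the hyperbola degenerates to the
  perpendicular bisector of the foci.\<close>

definition ellipse :: "real^2 \<Rightarrow> real^2 \<Rightarrow> real \<Rightarrow> (real^2) set" where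
  "ellipse F1 F2 m = {P. dist P F1 + dist P F2 = m}"

definition hyperbola :: "real^2 \<Rightarrow> real^2 \<Rightarrow> real \<Rightarrow> (real^2) set" where
  "hyperbola F1 F2 m = {P. \<bar>dist P F1 - dist P F2\<bar> = m}"

text \<open>The branches of a hyperbola are its connected components.\<close>

definition hyperbola_branch :: "real^2 \<Rightarrow> real^2 \<Rightarrow> real \<Rightarrow> real^2 \<Rightarrow> (real^2) set" where
  "hyperbola_branch F1 F2 m V = connected_component_set (hyperbola F1 F2 m) V"

text \<open>Every point of the common normal \<^term>\<open>affine hull {c1, c2}\<close> near the vertex has the vertex as
  its nearest point on both circles, so it is trivially equidistant from them. Hence being the metric
  bisector cannot mean being the whole equidistance locus: it means being a metric bisector
  that contains every equidistant point off the common normal.\<close>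

definition the_metric_bisector ::
    "real^2 \<Rightarrow> real \<Rightarrow> real^2 \<Rightarrow> real \<Rightarrow> (real^2) set \<Rightarrow> bool" where
  "the_metric_bisector c1 r1 c2 r2 C \<longleftrightarrow>
     metric_bisector (sphere c1 r1) (sphere c2 r2) C \<and>
     (\<forall>P. infdist P (sphere c1 r1) = infdist P (sphere c2 r2) \<longrightarrow>
        P \<in> C \<or> P \<in> affine hull {c1, c2})"

end

theory Submission
  imports Defs
begin

text \<open>The distance from \<open>P\<close> to a circle is \<open>\<bar>dist P c - r\<bar>\<close>, so \<open>P\<close> is equidistant from the two
  circles iff \<open>dist P c1 - r1 = \<plusminus> (dist P c2 - r2)\<close>. Tangency makes \<open>c1\<close>, \<open>c2\<close>, \<open>V\<close> collinear, with
  \<open>dist c1 c2 = \<bar>r1 - r2\<bar>\<close> or \<open>dist c1 c2 = r1 + r2\<close>. For one choice of the sign the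
  equation is that of the conic; for the other choice it is the equality case of the triangle
  inequality, which puts \<open>P\<close> on the line through the centres. In an orthonormal frame at
  the midpoint of the foci the conics have the usual explicit parametrisations.\<close>

section \<open>Distance to a circle, equality in the triangle inequality, tangency\<close>

lemma infdist_sphere:
  fixes c P :: "'a::euclidean_space"
  assumes "0 \<le> r"
  shows "infdist P (sphere c r) = \<bar>dist P c - r\<bar>"
proof -
  obtain y where y: "y \<in> sphere c r" "dist P y = \<bar>dist P c - r\<bar>"
  proof (cases "P = c")
    case True
    obtain y where "dist c y = r"
      using vector_choose_dist[OF assms] by blast
    with True assms that show ?thesis by auto
  next
    case False
    define d where "d = norm (P - c)"
    have d: "d > 0" using False by (simp add: d_def)
    \<comment> \<open>The nearest point is the radial projection of \<open>P\<close>. It is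
      undefined at the centre, where every point of the sphere is nearest.\<close>
    let ?y = "c + (r / d) *\<^sub>R (P - c)"
    have "?y \<in> sphere c r"
      using d assms by (simp add: dist_norm flip: d_def)
    moreover have "P - ?y = (1 - r / d) *\<^sub>R (P - c)"
      by (simp add: algebra_simps)
    then have "dist P ?y = \<bar>1 - r / d\<bar> * d"
      by (simp only: dist_norm norm_scaleR d_def)
    then have "dist P ?y = \<bar>d - r\<bar>"
      using d by (simp add: abs_if field_simps split: if_splits)
    ultimately show ?thesis by (intro that[of ?y]) (simp_all add: dist_norm d_def)
  qed
  have ne: "sphere c r \<noteq> {}" using y by blast
  have "\<bar>dist P c - r\<bar> \<le> infdist P (sphere c r)"
    unfolding infdist_notempty[OF ne]
  proof (rule cINF_greatest[OF ne])
    fix z assume "z \<in> sphere c r"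
    then have "dist c z = r" by simp
    moreover have "dist P c \<le> dist P z + dist c z" "dist c z \<le> dist P z + dist P c"
      by (metis dist_commute dist_triangle)+
    ultimately show "\<bar>dist P c - r\<bar> \<le> dist P z" by linarith
  qed
  with infdist_le[OF y(1), of P] y(2) show ?thesis by linarith
qed

text \<open>Equality in the triangle inequality: the focus nearer to \<open>P\<close> lies between
  \<open>P\<close> and the other one. For \<open>F = G\<close> the equation would hold for every
  \<open>P\<close>.\<close>

lemma dist_diff_eq_imp_affine_hull:
  fixes F G P :: "'a::euclidean_space"
  assumes "F \<noteq> G" "\<bar>dist P F - dist P G\<bar> = dist F G"
  shows "P \<in> affine hull {F, G}"
proof -
  have "between (P, F) G \<or> between (P, G) F"
    using assms(2) by (auto simp: between dist_commute abs_if split: if_splits)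
  then have "collinear {F, G, P}"
    by (metis between_imp_collinear insert_commute)
  with assms(1) show ?thesis by (simp add: collinear_3_affine_hull)
qed

lemma dist_sum_eq_imp_affine_hull:
  fixes F G P :: "'a::euclidean_space"
  assumes "dist P F + dist P G = dist F G"
  shows "P \<in> affine hull {F, G}"
proof -
  have "P \<in> closed_segment F G"
    using assms by (simp add: between dist_commute flip: between_mem_segment)
  then show ?thesis
    using convex_hull_subset_affine_hull segment_convex_hull by blast
qed

text \<open>With \<open>n\<close> the unit outer normal, \<open>c + r n\<close> is the point of the
  sphere farthest in direction \<open>n\<close>. As it stays in the half-space, \<open>r\<close> is
  at most \<open>n \<bullet> (V - c)\<close>; since \<open>V - c\<close> has length
  \<open>r\<close>, this is equality in Cauchy-Schwarz, so \<open>V - c = r n\<close>.\<close>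

lemma center_of_tangent_sphere:
  fixes V c a :: "'a::real_inner"
  assumes "a \<noteq> 0" "0 < r" and V: "V \<in> sphere c r" "a \<bullet> V = b"
    and S: "sphere c r \<subseteq> {x. a \<bullet> x \<le> b}"
  shows "c = V - r *\<^sub>R (a /\<^sub>R norm a)"
proof -
  define n where "n = a /\<^sub>R norm a"
  have n: "n \<bullet> n = 1" "a = norm a *\<^sub>R n"
    using assms(1) by (auto simp: n_def dot_square_norm power2_eq_square)
  have "c + r *\<^sub>R n \<in> sphere c r"
    using n(1) assms(2) by (simp add: dist_norm norm_eq_1)
  then have "a \<bullet> (c + r *\<^sub>R n) \<le> a \<bullet> V"
    using S V(2) by blast
  then have "norm a * (n \<bullet> (c + r *\<^sub>R n)) \<le> norm a * (n \<bullet> V)"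
    using n(2) by (metis inner_scaleR_left)
  then have "n \<bullet> (c + r *\<^sub>R n) \<le> n \<bullet> V"
    using assms(1) by simp
  then have le: "r \<le> n \<bullet> (V - c)"
    using n(1) by (simp add: algebra_simps)
  have "(V - c) \<bullet> (V - c) = r\<^sup>2"
    using V(1) by (simp add: dist_norm norm_minus_commute flip: power2_norm_eq_inner)
  \<comment> \<open>The equality case is obtained by showing that the squared length of the
    difference is at most 0.\<close>
  then have "(V - c - r *\<^sub>R n) \<bullet> (V - c - r *\<^sub>R n) = 2 * r * (r - n \<bullet> (V - c))"
    using n(1) by (simp add: inner_commute power2_eq_square algebra_simps)
  also have "\<dots> \<le> 0"
    using le assms(2) by (simp add: mult_le_0_iff)
  finally have "V - c - r *\<^sub>R n = 0"
    by (metis inner_eq_zero_iff inner_ge_zero order_antisym)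
  then show ?thesis by (simp add: n_def algebra_simps)
qed

section \<open>Cartesian equations of the conics\<close>

lemma ellipse_equation:
  fixes a b f x y :: real
  assumes "\<bar>f\<bar> < a" "0 < b" "b\<^sup>2 = a\<^sup>2 - f\<^sup>2"
  shows "sqrt ((x + f)\<^sup>2 + y\<^sup>2) + sqrt ((x - f)\<^sup>2 + y\<^sup>2) = 2 * a \<longleftrightarrow> (x / a)\<^sup>2 + (y / b)\<^sup>2 = 1"
proof -
  define d1 d2 where d: "d1 = sqrt ((x + f)\<^sup>2 + y\<^sup>2)" "d2 = sqrt ((x - f)\<^sup>2 + y\<^sup>2)"
  have sq: "d1\<^sup>2 = (x + f)\<^sup>2 + y\<^sup>2" "d2\<^sup>2 = (x - f)\<^sup>2 + y\<^sup>2"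
    by (simp_all add: d)
  have a: "a > 0" using assms(1) by linarith
  have eq: "(x / a)\<^sup>2 + (y / b)\<^sup>2 = 1 \<longleftrightarrow> x\<^sup>2 * b\<^sup>2 + y\<^sup>2 * a\<^sup>2 = a\<^sup>2 * b\<^sup>2"
    using a assms(2) by (auto simp: field_simps)
  have "x\<^sup>2 * b\<^sup>2 + y\<^sup>2 * a\<^sup>2 = a\<^sup>2 * b\<^sup>2" if "d1 + d2 = 2 * a"
  proof -
    \<comment> \<open>Subtracting and adding the two squared distances gives
      \<open>a * m = x * f\<close> and the formula for \<open>a\<^sup>2 + m\<^sup>2\<close>;
      eliminating \<open>m\<close> leaves the equation.\<close>
    define m where "m = (d1 - d2) / 2"
    have m: "d1 = a + m" "d2 = a - m" using that by (simp_all add: m_def field_simps)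
    have "a * m = x * f" and s: "a\<^sup>2 + m\<^sup>2 = x\<^sup>2 + f\<^sup>2 + y\<^sup>2"
      using sq unfolding m by (simp_all add: power2_eq_square algebra_simps)
    then have "a\<^sup>2 * m\<^sup>2 = x\<^sup>2 * f\<^sup>2" by (metis power_mult_distrib)
    moreover have "a\<^sup>2 * (a\<^sup>2 + m\<^sup>2) = a\<^sup>2 * (x\<^sup>2 + f\<^sup>2 + y\<^sup>2)" using s by simp
    ultimately show ?thesis unfolding assms(3) by (simp add: algebra_simps)
  qed
  moreover have "d1 + d2 = 2 * a" if "(x / a)\<^sup>2 + (y / b)\<^sup>2 = 1"
  proof -
    define c s where cs: "c = x / a" "s = y / b"
    have xy: "x = a * c" "y = b * s" using a assms(2) by (simp_all add: cs)
    have one: "s\<^sup>2 = 1 - c\<^sup>2" using that by (simp add: cs)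
    then have "c\<^sup>2 \<le> 1" by (metis diff_ge_0_iff_ge zero_le_power2)
    then have "\<bar>c\<bar> \<le> 1" by (simp add: abs_square_le_1)
    then have "\<bar>f\<bar> * \<bar>c\<bar> \<le> \<bar>f\<bar>"
      by (simp add: mult_left_le)
    \<comment> \<open>This fixes the signs when taking roots: the focal distances are
      \<open>a + f * c\<close> and \<open>a - f * c\<close>, both nonnegative.\<close>
    then have fc: "\<bar>f * c\<bar> \<le> a" using assms(1) by (simp add: abs_mult)
    have "(x + f)\<^sup>2 + y\<^sup>2 = (a + f * c)\<^sup>2" "(x - f)\<^sup>2 + y\<^sup>2 = (a - f * c)\<^sup>2"
      unfolding xy power_mult_distrib[of b] one assms(3)
      by (simp_all add: power2_eq_square algebra_simps)
    with fc show ?thesis by (simp add: d)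
  qed
  ultimately show ?thesis using eq d by auto
qed

text \<open>The signed difference \<open>2 * a\<close> singles out one branch, so the equation is
  solved for \<open>x\<close> instead of being left in squared form, and \<open>a = 0\<close> gives
  the perpendicular bisector.\<close>

lemma hyperbola_branch_equation:
  fixes a b f x y :: real
  assumes "\<bar>a\<bar> < f" "0 < b" "b\<^sup>2 = f\<^sup>2 - a\<^sup>2"
  shows "sqrt ((x + f)\<^sup>2 + y\<^sup>2) - sqrt ((x - f)\<^sup>2 + y\<^sup>2) = 2 * a \<longleftrightarrow> x = a * sqrt (1 + (y / b)\<^sup>2)"
proof -
  define d1 d2 where d: "d1 = sqrt ((x + f)\<^sup>2 + y\<^sup>2)" "d2 = sqrt ((x - f)\<^sup>2 + y\<^sup>2)"
  have sq: "d1\<^sup>2 = (x + f)\<^sup>2 + y\<^sup>2" "d2\<^sup>2 = (x - f)\<^sup>2 + y\<^sup>2" and nonneg: "0 \<le> d1" "0 \<le> d2"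
    by (simp_all add: d)
  define s where "s = sqrt (1 + (y / b)\<^sup>2)"
  have f: "f > 0" using assms(1) by linarith
  have s2: "s\<^sup>2 = 1 + (y / b)\<^sup>2" and s1: "1 \<le> s" by (simp_all add: s_def)
  have y: "y\<^sup>2 = b\<^sup>2 * (s\<^sup>2 - 1)" using assms(2) s2 by (simp add: field_simps)
  have "x = a * s" if "d1 - d2 = 2 * a"
  proof -
    \<comment> \<open>The half-sum turns out to be \<open>f * s\<close>. Then
      \<open>a * m = x * f\<close> yields \<open>x\<close> after division by \<open>f\<close> only,
      which covers \<open>a = 0\<close>.\<close>
    define m where "m = (d1 + d2) / 2"
    have m: "d1 = m + a" "d2 = m - a" using that by (simp_all add: m_def field_simps)
    have xf: "a * m = x * f" and "a\<^sup>2 + m\<^sup>2 = x\<^sup>2 + f\<^sup>2 + y\<^sup>2"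
      using sq unfolding m by (simp_all add: power2_eq_square algebra_simps)
    then have "f\<^sup>2 * (a\<^sup>2 + m\<^sup>2) = f\<^sup>2 * (x\<^sup>2 + f\<^sup>2 + y\<^sup>2)" by simp
    moreover have "a\<^sup>2 * m\<^sup>2 = x\<^sup>2 * f\<^sup>2" using xf by (metis power_mult_distrib)
    ultimately have "b\<^sup>2 * m\<^sup>2 = b\<^sup>2 * (f * s)\<^sup>2"
      unfolding y assms(3) by (simp add: algebra_simps)
    then have "m\<^sup>2 = (f * s)\<^sup>2" using assms(2) by simp
    moreover have "0 \<le> m" using nonneg by (simp add: m_def)
    ultimately have "m = f * s" using f s1 by simp
    with xf f show ?thesis by simp
  qed
  moreover have "d1 - d2 = 2 * a" if "x = a * s"
  proof -
    have "f \<le> f * s" using f s1 by simp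
    then have "\<bar>a\<bar> \<le> f * s" using assms(1) by linarith
    moreover have "(x + f)\<^sup>2 + y\<^sup>2 = (f * s + a)\<^sup>2" "(x - f)\<^sup>2 + y\<^sup>2 = (f * s - a)\<^sup>2"
      unfolding y assms(3) that by (simp_all add: power2_eq_square algebra_simps)
    ultimately show ?thesis by (simp add: d)
  qed
  ultimately show ?thesis unfolding d[symmetric] s_def[symmetric] by blast
qed

section \<open>Orthonormal frames of the plane\<close>

text \<open>For a unit vector \<open>u\<close>, the second axis is \<open>u\<close> turned
  counterclockwise by a right angle.\<close>

definition frame :: "real^2 \<Rightarrow> real^2 \<Rightarrow> real \<Rightarrow> real \<Rightarrow> real^2" where
  "frame p u x y = p + x *\<^sub>R u + y *\<^sub>R vector [- u$2, u$1]"

lemma frame_surj: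
  assumes "norm u = 1"
  obtains x y where "P = frame p u x y"
proof -
  have "u$1 * u$1 + u$2 * u$2 = 1"
    using assms by (simp add: norm_eq_1 inner_vec_def sum_2)
  \<comment> \<open>The coordinates are the inner products of \<open>P - p\<close> with the two
    axes.\<close>
  then have "P = frame p u ((P - p)$1 * u$1 + (P - p)$2 * u$2) ((P - p)$2 * u$1 - (P - p)$1 * u$2)"
    unfolding frame_def vec_eq_iff forall_2
    apply (simp add: algebra_simps)
    apply algebra
    done
  then show ?thesis by (rule that)
qed

lemma dist_frame:
  assumes "norm u = 1"
  shows "dist (frame p u x y) (frame p u x' y') = sqrt ((x - x')\<^sup>2 + (y - y')\<^sup>2)"
proof -
  have "u$1 * u$1 + u$2 * u$2 = 1"
    using assms by (simp add: norm_eq_1 inner_vec_def sum_2)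
  then have "(x - x')\<^sup>2 + (y - y')\<^sup>2 =
      ((x - x') * u$1 - (y - y') * u$2)\<^sup>2 + ((x - x') * u$2 + (y - y') * u$1)\<^sup>2"
    by algebra
  then show ?thesis
    by (simp add: frame_def dist_norm norm_vec_def L2_set_def sum_2 algebra_simps)
qed

lemma frame_inject:
  assumes "norm u = 1"
  shows "frame p u x y = frame p u x' y' \<longleftrightarrow> x = x' \<and> y = y'"
proof -
  have "frame p u x y = frame p u x' y' \<longleftrightarrow> (x - x')\<^sup>2 + (y - y')\<^sup>2 = 0"
    by (metis dist_eq_0_iff dist_frame[OF assms] real_sqrt_eq_0_iff)
  then show ?thesis by simp
qed

lemma continuous_on_frame [continuous_intros]:
  assumes "continuous_on I f" "continuous_on I g"
  shows "continuous_on I (\<lambda>t. frame p u (f t) (g t))"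
  unfolding frame_def by (intro continuous_intros assms)

lemma foci_frame:
  assumes "F1 \<noteq> F2"
  obtains p u f where "norm u = 1" "f = dist F1 F2 / 2" "F1 = frame p u (-f) 0" "F2 = frame p u f 0"
proof -
  let ?u = "(F2 - F1) /\<^sub>R dist F1 F2"
  let ?p = "midpoint F1 F2"
  have "norm ?u = 1" using assms by (simp add: dist_norm norm_minus_commute)
  moreover have "F1 = frame ?p ?u (- (dist F1 F2 / 2)) 0" "F2 = frame ?p ?u (dist F1 F2 / 2) 0"
    using assms by (simp_all add: frame_def midpoint_def vec_eq_iff forall_2 field_simps)
  ultimately show ?thesis using that by blast
qed

section \<open>The conics as curves\<close>

lemma curve_ellipse:
  assumes "F1 \<noteq> F2" "dist F1 F2 < m"
  shows "curve (ellipse F1 F2 m)"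
proof -
  obtain p u f where u: "norm u = 1" and f: "f = dist F1 F2 / 2"
    and F: "F1 = frame p u (-f) 0" "F2 = frame p u f 0"
    using foci_frame[OF assms(1)] by blast
  define a where "a = m / 2"
  have a: "\<bar>f\<bar> < a" using assms(2) by (simp add: f a_def)
  then have a0: "a > 0" by linarith
  define b where "b = sqrt (a\<^sup>2 - f\<^sup>2)"
  have "f\<^sup>2 < a\<^sup>2" using power_strict_mono[OF a, of 2] by simp
  then have b: "0 < b" "b\<^sup>2 = a\<^sup>2 - f\<^sup>2" by (simp_all add: b_def)
  let ?g = "\<lambda>t. frame p u (a * cos t) (b * sin t)"
  have iff: "frame p u x y \<in> ellipse F1 F2 m \<longleftrightarrow> (x / a)\<^sup>2 + (y / b)\<^sup>2 = 1" for x y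
    using ellipse_equation[OF a b, of x y] unfolding F
    by (simp add: ellipse_def dist_frame[OF u] a_def)
  have "?g ` {0..2 * pi} = ellipse F1 F2 m"
  proof (intro equalityI subsetI)
    fix P assume "P \<in> ellipse F1 F2 m"
    moreover obtain x y where P: "P = frame p u x y" using frame_surj[OF u] by blast
    ultimately have "(x / a)\<^sup>2 + (y / b)\<^sup>2 = 1" using iff by simp
    then obtain t where "0 \<le> t" "t < 2 * pi" "x / a = cos t" "y / b = sin t"
      using sincos_total_2pi by metis
    then show "P \<in> ?g ` {0..2 * pi}"
      using P a0 b(1) by (intro image_eqI[of _ _ t]) (auto simp: field_simps)
  qed (use a0 b(1) iff in auto)
  \<comment> \<open>The parameters 0 and 2 pi give the same point, so injectivity is claimed on the
    open interval, where two parameters differ by less than one period.\<close>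
  moreover have "inj_on ?g {0<..<2 * pi}"
  proof (rule inj_onI)
    fix s t assume st: "s \<in> {0<..<2 * pi}" "t \<in> {0<..<2 * pi}" and "?g s = ?g t"
    then have "sin s = sin t \<and> cos s = cos t"
      using a0 b(1) by (simp add: frame_inject[OF u])
    then obtain k :: int where k: "s = t + 2 * pi * k"
      using sin_cos_eq_iff by blast
    have "2 * pi * \<bar>real_of_int k\<bar> = \<bar>s - t\<bar>" using k by (simp add: abs_mult)
    also have "\<dots> < 2 * pi * 1" using st by (auto simp: abs_if)
    finally have "\<bar>real_of_int k\<bar> < 1" by (simp add: mult_less_cancel_left_pos)
    then have "k = 0" by linarith
    with k show "s = t" by simp
  qed
  moreover have "continuous_on {0..2 * pi} ?g" by (intro continuous_intros)
  ultimately show ?thesis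
    unfolding curve_def
    by (intro exI[of _ "{0..2 * pi}"] exI[of _ ?g]) (auto simp: pi_gt_zero[folded not_le])
qed

lemma curve_connected_hyperbola_branch:
  assumes "\<bar>m\<bar> < dist F1 F2"
  shows "curve {P. dist P F1 - dist P F2 = m}" "connected {P. dist P F1 - dist P F2 = m}"
proof -
  let ?B = "{P. dist P F1 - dist P F2 = m}"
  have "F1 \<noteq> F2" using assms by auto
  then obtain p u f where u: "norm u = 1" and f: "f = dist F1 F2 / 2"
    and F: "F1 = frame p u (-f) 0" "F2 = frame p u f 0"
    using foci_frame by blast
  define a where "a = m / 2"
  have a: "\<bar>a\<bar> < f" using assms by (simp add: f a_def)
  define b where "b = sqrt (f\<^sup>2 - a\<^sup>2)"
  have "a\<^sup>2 < f\<^sup>2" using power_strict_mono[OF a, of 2] by simp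
  then have b: "0 < b" "b\<^sup>2 = f\<^sup>2 - a\<^sup>2" by (simp_all add: b_def)
  \<comment> \<open>A branch is a graph over the second axis, parametrised by
    \<open>t = y / b\<close> on the whole real line; connectedness follows from this.\<close>
  let ?g = "\<lambda>t. frame p u (a * sqrt (1 + t\<^sup>2)) (b * t)"
  have iff: "frame p u x y \<in> ?B \<longleftrightarrow> x = a * sqrt (1 + (y / b)\<^sup>2)" for x y
    using hyperbola_branch_equation[OF a b, of x y] unfolding F
    by (simp add: dist_frame[OF u] a_def)
  have img: "?g ` UNIV = ?B"
  proof (intro equalityI subsetI)
    fix P assume "P \<in> ?B"
    moreover obtain x y where P: "P = frame p u x y" using frame_surj[OF u] by blast
    ultimately have "x = a * sqrt (1 + (y / b)\<^sup>2)" using iff by simp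
    then show "P \<in> ?g ` UNIV"
      using P b(1) by (intro image_eqI[of _ _ "y / b"]) auto
  next
    fix P assume "P \<in> ?g ` UNIV"
    then show "P \<in> ?B" using iff b(1) by fastforce
  qed
  have cont: "continuous_on UNIV ?g" by (intro continuous_intros)
  have "inj ?g" using b(1) by (intro injI) (simp add: frame_inject[OF u])
  with img cont show "curve ?B"
    unfolding curve_def by (intro exI[of _ UNIV] exI[of _ ?g]) auto
  show "connected ?B"
    using connected_continuous_image[OF cont connected_UNIV] unfolding img .
qed

text \<open>The hyperbola is the union of the closed sets \<open>?B\<close> and \<open>?B'\<close>
  for the two signs of the difference. For nonzero \<open>m\<close> they are disjoint, so the
  component of \<open>V\<close> stays in \<open>?B\<close>, which is itself connected; for
  \<open>m = 0\<close> they coincide.\<close>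

lemma hyperbola_branch_eq:
  assumes "\<bar>m\<bar> < dist F1 F2" "dist V F1 - dist V F2 = m"
  shows "hyperbola_branch F1 F2 \<bar>m\<bar> V = {P. dist P F1 - dist P F2 = m}" (is "?C = ?B")
proof
  show "?B \<subseteq> ?C"
    unfolding hyperbola_branch_def
    using curve_connected_hyperbola_branch(2)[OF assms(1)] assms(2)
    by (intro connected_component_maximal) (auto simp: hyperbola_def)
  let ?B' = "{P. dist P F1 - dist P F2 = - m}"
  have C: "?C \<subseteq> hyperbola F1 F2 \<bar>m\<bar>" "connected ?C"
    by (simp_all add: hyperbola_branch_def connected_component_subset)
  then have sub: "?C \<subseteq> ?B \<union> ?B'" by (auto simp: hyperbola_def)
  have V: "V \<in> ?C"
    using assms(2) by (simp add: hyperbola_branch_def hyperbola_def connected_component_refl)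
  show "?C \<subseteq> ?B"
  proof (cases "m = 0")
    case False
    have "closed ?B" "closed ?B'"
      by (intro closed_Collect_eq continuous_intros)+
    moreover have "?B \<inter> ?B' \<inter> ?C = {}" using False by auto
    ultimately have "?B \<inter> ?C = {} \<or> ?B' \<inter> ?C = {}"
      using connected_closedD[OF C(2) _ sub] by blast
    with V assms(2) sub show ?thesis by auto
  qed (use sub in auto)
qed

section \<open>The two positions of the circles\<close>

theorem theorem2:
  fixes c1 c2 V :: "real^2" and r1 r2 :: real and L :: "(real^2) set"
  assumes "horn_angle c1 r1 c2 r2 V L"
  shows "(same_side L (sphere c1 r1) (sphere c2 r2) \<longrightarrow>
            V \<in> ellipse c1 c2 (r1 + r2) \<and>
            the_metric_bisector c1 r1 c2 r2 (ellipse c1 c2 (r1 + r2))) \<and>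
         (opposite_sides L (sphere c1 r1) (sphere c2 r2) \<longrightarrow>
            V \<in> hyperbola c1 c2 \<bar>r1 - r2\<bar> \<and>
            the_metric_bisector c1 r1 c2 r2 (hyperbola_branch c1 c2 \<bar>r1 - r2\<bar> V))"
proof -
  have r: "0 < r1" "0 < r2" and ne: "sphere c1 r1 \<noteq> sphere c2 r2"
    and V: "V \<in> sphere c1 r1" "V \<in> sphere c2 r2" "V \<in> L"
    using assms unfolding horn_angle_def tangent_line_def by blast+
  then have dV: "dist V c1 = r1" "dist V c2 = r2" by (simp_all add: dist_commute)
  have inf: "infdist P (sphere c1 r1) = infdist P (sphere c2 r2) \<longleftrightarrow>
      dist P c1 + dist P c2 = r1 + r2 \<or> dist P c1 - dist P c2 = r1 - r2" for P
    using r by (auto simp: infdist_sphere)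
  have "the_metric_bisector c1 r1 c2 r2 (ellipse c1 c2 (r1 + r2))"
    if same: "same_side L (sphere c1 r1) (sphere c2 r2)"
  proof -
    obtain a b where a: "a \<noteq> 0" and L: "L = {x. a \<bullet> x = b}"
      and S: "sphere c1 r1 \<subseteq> {x. a \<bullet> x \<le> b}" "sphere c2 r2 \<subseteq> {x. a \<bullet> x \<le> b}"
      using same unfolding same_side_def by blast
    define n where "n = a /\<^sub>R norm a"
    have n: "norm n = 1" using a by (simp add: n_def)
    have c: "c1 = V - r1 *\<^sub>R n" "c2 = V - r2 *\<^sub>R n"
      using center_of_tangent_sphere[OF a r(1) V(1) _ S(1)]
        center_of_tangent_sphere[OF a r(2) V(2) _ S(2)] V(3) L by (simp_all add: n_def)
    \<comment> \<open>Equal radii would give equal centres, hence equal circles. So the foci are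
      distinct and the ellipse has a well-defined focal axis.\<close>
    have "r1 \<noteq> r2" using ne c by auto
    have "c1 - c2 = (r2 - r1) *\<^sub>R n" unfolding c by (simp add: algebra_simps)
    then have dc: "dist c1 c2 = \<bar>r1 - r2\<bar>" using n by (simp add: dist_norm)
    with \<open>r1 \<noteq> r2\<close> have "c1 \<noteq> c2" by auto
    with dc r have "curve (ellipse c1 c2 (r1 + r2))" by (intro curve_ellipse) auto
    moreover have "P \<in> affine hull {c1, c2}" if "dist P c1 - dist P c2 = r1 - r2" for P
      using dist_diff_eq_imp_affine_hull[OF \<open>c1 \<noteq> c2\<close>] that dc by simp
    ultimately show ?thesis
      unfolding the_metric_bisector_def metric_bisector_def inf by (auto simp: ellipse_def)
  qed
  moreover have "the_metric_bisector c1 r1 c2 r2 (hyperbola_branch c1 c2 \<bar>r1 - r2\<bar> V)"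
    if opp: "opposite_sides L (sphere c1 r1) (sphere c2 r2)"
  proof -
    obtain a b where a: "a \<noteq> 0" and L: "L = {x. a \<bullet> x = b}"
      and S: "sphere c1 r1 \<subseteq> {x. a \<bullet> x \<le> b}" "sphere c2 r2 \<subseteq> {x. a \<bullet> x \<ge> b}"
      using opp unfolding opposite_sides_def by blast
    define n where "n = a /\<^sub>R norm a"
    have n: "norm n = 1" using a by (simp add: n_def)
    \<comment> \<open>Negating the normal brings the second circle into the form of the tangency
      lemma, so its centre lies on the other side of \<open>V\<close>.\<close>
    have S': "sphere c2 r2 \<subseteq> {x. (- a) \<bullet> x \<le> - b}" using S(2) by auto
    have c: "c1 = V - r1 *\<^sub>R n" "c2 = V + r2 *\<^sub>R n"
      using center_of_tangent_sphere[OF a r(1) V(1) _ S(1)]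
        center_of_tangent_sphere[OF _ r(2) V(2) _ S'] a V(3) L by (simp_all add: n_def)
    have "c1 - c2 = - (r1 + r2) *\<^sub>R n" unfolding c by (simp add: algebra_simps)
    then have dc: "dist c1 c2 = r1 + r2" using n r by (simp add: dist_norm)
    \<comment> \<open>Strictness holds because both radii are positive. Equal radii are allowed here
      and give the perpendicular bisector.\<close>
    have lt: "\<bar>r1 - r2\<bar> < dist c1 c2" using dc r by auto
    have "P \<in> affine hull {c1, c2}" if "dist P c1 + dist P c2 = r1 + r2" for P
      using that dc by (intro dist_sum_eq_imp_affine_hull) simp
    then show ?thesis
      using curve_connected_hyperbola_branch(1)[OF lt] hyperbola_branch_eq[OF lt] dV
      unfolding the_metric_bisector_def metric_bisector_def inf by auto
  qed
  ultimately show ?thesis using dV by (auto simp: ellipse_def hyperbola_def)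
qed

end
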